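(* Let $\delta$ be an infinite cardinal and let $\mathbb{B}$ be a ${<}\delta$-disjointable ${<}\delta$-complete Boolean algebra of cardinality $\delta$. For every $E\subseteq\mathbb{B}$ with $|E|<\delta$ and the finite intersection property, there exists a countably incomplete ${<}\delta$-good ultrafilter $U$ on $\mathbb{B}$ such that $E\subseteq U$.
   Context: $\mathbb{B}$ is ${<}\delta$-complete if every subset of size $<\delta$ has a supremum and an infimum. $\mathbb{B}$ is ${<}\delta$-disjointable if for every $\lambda<\delta$ and every $f\colon\lambda\to\mathbb{B}\setminus\{\mathbb{0}\}$ there is $g\colon\lambda\to\mathbb{B}\setminus\{\mathbb{0}\}$ with $g(\alpha)\le f(\alpha)$ for all $\alpha$ and $g(\alpha)\wedge g(\beta)=\mathbb{0}$ for $\beta<\alpha<\lambda$. For a cardinal $\lambda$, a function $f\colon[\lambda]^{<\aleph_0}\to\mathbb{B}$ is monotonic if $S\subseteq T$ implies $f(T)\le f(S)$, and multiplicative if $f(S\cup T)=f(S)\wedge f(T)$. An ultrafilter $U$ on $\mathbb{B}$ is ${<}\delta$-good if for every $\lambda<\delta$ and every monotonic $f\colon[\lambda]^{<\aleph_0}\to U$ there is a multiplicative $g\colon[\lambda]^{<\aleph_0}\to U$ with $g(S)\le f(S)$ for all $S$. $U$ is countably incomplete if there is a countable $Y\subseteq U$ with $\bigwedge Y=\mathbb{0}$. *)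

theory Defs
  imports "HOL-Library.Lub_Glb" "HOL-Library.Countable_Set" "HOL-Library.FuncSet"
begin

unbundle cardinal_syntax and lattice_syntax

text \<open>
  A Boolean algebra is a type of class \<^class>\<open>boolean_algebra\<close>. Following the BNF cardinal library,
  a cardinal is a well-order \<open>r\<close> with \<^term>\<open>Card_order r\<close>; its elements (the ordinals below it)
  are \<^term>\<open>Field r\<close>. A cardinal \<open>\<kappa> < \<delta>\<close> ranges over the cardinal well-orders
  on the same type as \<open>\<delta>\<close>: every cardinal below \<open>\<delta>\<close> has such a representative, since it
  embeds into \<^term>\<open>Field \<delta>\<close>.
\<close>

definition lt_complete :: "'d rel \<Rightarrow> 'a::boolean_algebra itself \<Rightarrow> bool" where
  "lt_complete \<delta> (_ :: 'a itself) \<longleftrightarrow>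
    (\<forall>A :: 'a set. |A| <o \<delta> \<longrightarrow> (\<exists>s. isLub UNIV A s) \<and> (\<exists>i. isGlb UNIV A i))"

definition lt_disjointable :: "'d rel \<Rightarrow> 'a::boolean_algebra itself \<Rightarrow> bool" where
  "lt_disjointable \<delta> (_ :: 'a itself) \<longleftrightarrow>
    (\<forall>\<kappa> :: 'd rel. Card_order \<kappa> \<and> \<kappa> <o \<delta> \<longrightarrow>
      (\<forall>f :: 'd \<Rightarrow> 'a. f \<in> Field \<kappa> \<rightarrow> - {\<bottom>} \<longrightarrow>
        (\<exists>g \<in> Field \<kappa> \<rightarrow> - {\<bottom>}.
          (\<forall>\<alpha> \<in> Field \<kappa>. g \<alpha> \<le> f \<alpha>) \<and>
          (\<forall>\<alpha> \<in> Field \<kappa>. \<forall>\<beta> \<in> underS \<kappa> \<alpha>. g \<alpha> \<sqinter> g \<beta> = \<bottom>))))"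

text \<open>In the next two definitions \<open>X\<close> is the index set, so that \<^term>\<open>Fpow X\<close> is
  \<open>[X]\<close> to the power \<open>< \<aleph>\<^sub>0\<close>; only the values of \<open>f\<close> on \<^term>\<open>Fpow X\<close> matter.\<close>

definition monotonic_on :: "'d set \<Rightarrow> ('d set \<Rightarrow> 'a::boolean_algebra) \<Rightarrow> bool" where
  "monotonic_on X f \<longleftrightarrow> (\<forall>S \<in> Fpow X. \<forall>T \<in> Fpow X. S \<subseteq> T \<longrightarrow> f T \<le> f S)"

definition multiplicative_on :: "'d set \<Rightarrow> ('d set \<Rightarrow> 'a::boolean_algebra) \<Rightarrow> bool" where
  "multiplicative_on X f \<longleftrightarrow> (\<forall>S \<in> Fpow X. \<forall>T \<in> Fpow X. f (S \<union> T) = f S \<sqinter> f T)"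

definition ba_proper_filter :: "'a::boolean_algebra set \<Rightarrow> bool" where
  "ba_proper_filter U \<longleftrightarrow> \<top> \<in> U \<and> \<bottom> \<notin> U \<and>
    (\<forall>x \<in> U. \<forall>y \<in> U. x \<sqinter> y \<in> U) \<and> (\<forall>x \<in> U. \<forall>y. x \<le> y \<longrightarrow> y \<in> U)"

definition ba_ultrafilter :: "'a::boolean_algebra set \<Rightarrow> bool" where
  "ba_ultrafilter U \<longleftrightarrow> ba_proper_filter U \<and> (\<forall>x. x \<in> U \<or> - x \<in> U)"

definition lt_good :: "'d rel \<Rightarrow> 'a::boolean_algebra set \<Rightarrow> bool" where
  "lt_good \<delta> U \<longleftrightarrow>
    (\<forall>\<kappa> :: 'd rel. Card_order \<kappa> \<and> \<kappa> <o \<delta> \<longrightarrow>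
      (\<forall>f. f \<in> Fpow (Field \<kappa>) \<rightarrow> U \<and> monotonic_on (Field \<kappa>) f \<longrightarrow>
        (\<exists>g \<in> Fpow (Field \<kappa>) \<rightarrow> U. multiplicative_on (Field \<kappa>) g \<and>
          (\<forall>S \<in> Fpow (Field \<kappa>). g S \<le> f S))))"

definition countably_incomplete :: "'a::boolean_algebra set \<Rightarrow> bool" where
  "countably_incomplete U \<longleftrightarrow> (\<exists>Y \<subseteq> U. countable Y \<and> isGlb UNIV Y \<bottom>)"

text \<open>The meet of the empty family is \<open>\<top>\<close>, which is nonzero in every nontrivial algebra, so only
  nonempty finite subfamilies need to be considered.\<close>

definition fip :: "'a::boolean_algebra set \<Rightarrow> bool" where
  "fip E \<longleftrightarrow> (\<forall>F. F \<subseteq> E \<and> finite F \<and> F \<noteq> {} \<longrightarrow> Inf_fin F \<noteq> \<bottom>)"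

end

theory Submission
  imports Defs
begin

text \<open>
  Below every nonzero element there are \<open>\<delta>\<close> elements: otherwise, refining a constant family indexed by
  these elements to a disjoint one and taking joins over index sets would violate Cantor's theorem.
  Assembling arbitrary elements below the members of a disjoint family of size \<open>\<lambda> < \<delta>\<close> shows that
  \<open>\<delta>\<close> is regular and that there are only \<open>\<delta>\<close> functions from \<open>\<lambda>\<close> to the algebra.

  If \<open>E\<close> has fewer than \<open>\<delta>\<close> elements and, together with the range of a monotonic \<open>f\<close>, has the finite
  intersection property, refine the elements \<open>f S \<sqinter> e\<close>, for \<open>e\<close> a finite meet of \<open>E\<close>, to a disjoint
  family \<open>h\<close>. Then \<open>g T\<close>, the join of all \<open>h (S, e)\<close> with \<open>T \<subseteq> S\<close>, is multiplicative by
  disjointness, lies below \<open>f T\<close>, and meets every \<open>e\<close>. Handling all \<open>f\<close> in a recursion of length \<open>\<delta>\<close>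
  yields a set of which every ultrafilter extension is good. Countable incompleteness is ensured
  at the start by adding the joins of the tails of a disjoint refinement of \<open>(n, e) \<mapsto> e\<close>; if
  \<open>\<delta> = \<omega>\<close>, the algebra is countable and atomless, and every ultrafilter is itself a witness.
\<close>

section \<open>Finite subsets, finite meets and the finite intersection property\<close>

lemma card_of_Fpow_le:
  assumes "infinite X"
  shows "|Fpow X| \<le>o |X|"
proof -
  define N where "N n = {F. F \<subseteq> X \<and> finite F \<and> card F = n}" for n
  have "|N n| \<le>o |X|" for n
  proof (induction n)
    case 0
    have "N 0 = {{}}" unfolding N_def by auto
    then show ?case using assms by (simp add: card_of_singl_ordLeq infinite_imp_nonempty)
  next
    case (Suc n)
    have "N (Suc n) \<subseteq> (\<lambda>(x, F). insert x F) ` (X \<times> N n)"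
    proof
      fix F assume F: "F \<in> N (Suc n)"
      then obtain x G where "F = insert x G" "x \<notin> G" "card G = n"
        unfolding N_def by (auto simp: card_Suc_eq)
      then show "F \<in> (\<lambda>(x, F). insert x F) ` (X \<times> N n)"
        using F unfolding N_def by auto
    qed
    then have "|N (Suc n)| \<le>o |X \<times> N n|"
      using card_of_mono1 card_of_image ordLeq_transitive by blast
    also have "|X \<times> N n| \<le>o |X|"
      using card_of_Times_ordLeq_infinite_Field[of "|X|" X "N n"] assms Suc
      by (simp add: Field_card_of card_of_card_order_on card_of_mono1)
    finally show ?case .
  qed
  moreover have "|UNIV :: nat set| \<le>o |X|"
    using assms infinite_iff_card_of_nat by auto
  ultimately have "|\<Union>n. N n| \<le>o |X|"
    using card_of_UNION_ordLeq_infinite assms by blast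
  moreover have "Fpow X = (\<Union>n. N n)" unfolding N_def Fpow_def by auto
  ultimately show ?thesis by simp
qed

text \<open>\<open>Inf_fin\<close> is unspecified on the empty set; inserting \<open>\<top>\<close>
  gives the empty meet its usual value and changes no other meet.\<close>

definition finite_meets :: "'a::boolean_algebra set \<Rightarrow> 'a set" where
  "finite_meets E = (\<lambda>F. Inf_fin (insert \<top> F)) ` Fpow E"

lemma finite_meets_top: "\<top> \<in> finite_meets E"
  unfolding finite_meets_def by (rule image_eqI[of _ _ "{}"]) (auto simp: Fpow_def)

lemma finite_meets_superset: "E \<subseteq> finite_meets E"
proof
  fix x assume "x \<in> E"
  then show "x \<in> finite_meets E"
    unfolding finite_meets_def by (intro image_eqI[of _ _ "{x}"]) (auto simp: Fpow_def)
qed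

lemma Inf_fin_insert_top_Un:
  fixes F G :: "'a::boolean_algebra set"
  assumes "finite F" "finite G"
  shows "Inf_fin (insert \<top> (F \<union> G)) = Inf_fin (insert \<top> F) \<sqinter> Inf_fin (insert \<top> G)"
proof -
  have "Inf_fin (insert \<top> F \<union> insert \<top> G) = Inf_fin (insert \<top> F) \<sqinter> Inf_fin (insert \<top> G)"
    using assms by (intro Inf_fin.union) auto
  then show ?thesis by simp
qed

lemma finite_meets_inf:
  assumes "x \<in> finite_meets E" "y \<in> finite_meets E"
  shows "x \<sqinter> y \<in> finite_meets E"
proof -
  obtain F G where "F \<in> Fpow E" "G \<in> Fpow E"
    "x = Inf_fin (insert \<top> F)" "y = Inf_fin (insert \<top> G)"
    using assms unfolding finite_meets_def by blast
  then have "F \<union> G \<in> Fpow E" "x \<sqinter> y = Inf_fin (insert \<top> (F \<union> G))"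
    using Inf_fin_insert_top_Un[of F G] by (auto simp: Fpow_def)
  then show ?thesis unfolding finite_meets_def by blast
qed

lemma Inf_fin_insert_top:
  "finite F \<Longrightarrow> F \<noteq> {} \<Longrightarrow> Inf_fin (insert \<top> F) = Inf_fin (F :: 'a::boolean_algebra set)"
  by simp

lemma fip_iff_finite_meets:
  assumes "(\<bottom>::'a::boolean_algebra) \<noteq> \<top>"
  shows "fip (E::'a set) \<longleftrightarrow> \<bottom> \<notin> finite_meets E"
proof
  assume E: "fip E"
  show "\<bottom> \<notin> finite_meets E"
  proof
    assume "\<bottom> \<in> finite_meets E"
    then obtain F where F: "F \<subseteq> E" "finite F" "Inf_fin (insert \<top> F) = \<bottom>"
      unfolding finite_meets_def Fpow_def by auto
    then have "F \<noteq> {}" using assms by auto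
    then show False using E F Inf_fin_insert_top[of F] unfolding fip_def by metis
  qed
next
  assume E: "\<bottom> \<notin> finite_meets E"
  show "fip E"
    unfolding fip_def
  proof (intro allI impI notI)
    fix F assume F: "F \<subseteq> E \<and> finite F \<and> F \<noteq> {}" "Inf_fin F = \<bottom>"
    then have "\<bottom> = Inf_fin (insert \<top> F)" "F \<in> Fpow E"
      using Inf_fin_insert_top[of F] by (auto simp: Fpow_def)
    then show False using E unfolding finite_meets_def by blast
  qed
qed

lemma fip_subset: "fip F \<Longrightarrow> E \<subseteq> F \<Longrightarrow> fip E"
  unfolding fip_def by blast

lemma Inf_fin_closed:
  assumes "\<And>x y. x \<in> D \<Longrightarrow> y \<in> D \<Longrightarrow> x \<sqinter> y \<in> D" "finite F" "F \<noteq> {}" "F \<subseteq> D"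
  shows "Inf_fin F \<in> D"
  using assms(2-4) by (induction F rule: finite_ne_induct) (auto simp: assms(1))

text \<open>A finite subfamily splits into a part in \<open>E\<close> and a part in
  \<open>D\<close>; closure under meets puts a single element of \<open>D\<close> below the meet of
  the second part. So testing pairs \<open>e \<sqinter> d\<close> suffices.\<close>

lemma fip_Un:
  fixes E D :: "'a::boolean_algebra set"
  assumes nt: "(\<bottom>::'a) \<noteq> \<top>"
    and cl: "\<And>x y. x \<in> D \<Longrightarrow> y \<in> D \<Longrightarrow> x \<sqinter> y \<in> D" and "D \<noteq> {}"
    and ne: "\<And>e d. e \<in> finite_meets E \<Longrightarrow> d \<in> D \<Longrightarrow> e \<sqinter> d \<noteq> \<bottom>"
  shows "fip (E \<union> D)"
  unfolding fip_iff_finite_meets[OF nt]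
proof
  assume "\<bottom> \<in> finite_meets (E \<union> D)"
  then obtain F where F: "finite F" "F \<subseteq> E \<union> D" "Inf_fin (insert \<top> F) = \<bottom>"
    unfolding finite_meets_def Fpow_def by auto
  have eq: "Inf_fin (insert \<top> F) = Inf_fin (insert \<top> (F \<inter> E)) \<sqinter> Inf_fin (insert \<top> (F - E))"
    using F Inf_fin_insert_top_Un[of "F \<inter> E" "F - E"] by (simp add: Int_Diff_Un)
  have e: "Inf_fin (insert \<top> (F \<inter> E)) \<in> finite_meets E"
    using F unfolding finite_meets_def Fpow_def by auto
  obtain d where d: "d \<in> D" "d \<le> Inf_fin (insert \<top> (F - E))"
  proof (cases "F - E = {}")
    case True
    then show thesis using that \<open>D \<noteq> {}\<close> by (metis Inf_fin.singleton all_not_in_conv top_greatest)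
  next
    case False
    then have "Inf_fin (F - E) \<in> D"
      using F by (intro Inf_fin_closed cl) auto
    then show thesis using that F False by simp
  qed
  have "Inf_fin (insert \<top> (F \<inter> E)) \<sqinter> d \<le> \<bottom>"
    using eq d F(3) by (metis inf_mono order_refl)
  then show False using ne[OF e d(1)] by (simp add: bot_unique)
qed

lemma fip_Union_chain:
  assumes "\<C> \<noteq> {}" "subset.chain UNIV \<C>" "\<And>E. E \<in> \<C> \<Longrightarrow> fip E"
  shows "fip (\<Union>\<C>)"
  unfolding fip_def
proof (intro allI impI)
  fix F assume F: "F \<subseteq> \<Union>\<C> \<and> finite F \<and> F \<noteq> {}"
  then obtain E where "E \<in> \<C>" "F \<subseteq> E"
    using finite_subset_Union_chain[of F \<C> UNIV] assms by metis
  then show "Inf_fin F \<noteq> \<bottom>" using assms(3) F unfolding fip_def by blast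
qed

section \<open>Extension to ultrafilters\<close>

lemma fip_insert:
  assumes nt: "(\<bottom>::'a::boolean_algebra) \<noteq> \<top>" and "\<And>e. e \<in> finite_meets E \<Longrightarrow> e \<sqinter> x \<noteq> (\<bottom>::'a)"
  shows "fip (insert x E)"
  using fip_Un[OF nt, of "{x}" E] assms(2) by simp

text \<open>A set maximal among those with the finite intersection property omits \<open>x\<close>
  only if one of its finite meets is disjoint from \<open>x\<close>. The filter and ultrafilter laws
  are read off from this.\<close>

lemma ultrafilter_extension:
  fixes E :: "'a::boolean_algebra set"
  assumes nt: "(\<bottom>::'a) \<noteq> \<top>" and "fip E"
  obtains U where "ba_ultrafilter U" "E \<subseteq> U"
proof -
  have "\<exists>U\<in>{U. fip U \<and> E \<subseteq> U}. \<forall>X\<in>{U. fip U \<and> E \<subseteq> U}. U \<subseteq> X \<longrightarrow> X = U"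
  proof (rule subset_Zorn_nonempty)
    show "{U. fip U \<and> E \<subseteq> U} \<noteq> {}" using assms by auto
  next
    fix \<C> assume C: "\<C> \<noteq> {}" "subset.chain {U. fip U \<and> E \<subseteq> U} \<C>"
    then have "fip (\<Union>\<C>)"
      by (intro fip_Union_chain) (auto simp: subset.chain_def)
    then show "\<Union>\<C> \<in> {U. fip U \<and> E \<subseteq> U}"
      using C unfolding subset.chain_def by blast
  qed
  then obtain U where U: "fip U" "E \<subseteq> U" and max: "\<And>X. fip X \<Longrightarrow> U \<subseteq> X \<Longrightarrow> X = U"
    by (metis (mono_tags, lifting) mem_Collect_eq order_trans)
  have memI: "x \<in> U" if "\<And>e. e \<in> finite_meets U \<Longrightarrow> e \<sqinter> x \<noteq> \<bottom>" for x
    using max[OF fip_insert[OF nt that]] by blast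
  have bot: "\<bottom> \<notin> finite_meets U" using U fip_iff_finite_meets[OF nt] by blast
  have up: "y \<in> U" if "x \<in> finite_meets U" "x \<le> y" for x y
  proof (rule memI, rule notI)
    fix e assume e: "e \<in> finite_meets U" "e \<sqinter> y = \<bottom>"
    then have "e \<sqinter> x = \<bottom>" using that(2) by (metis bot_unique inf_mono order_refl)
    then show False using finite_meets_inf[OF e(1) that(1)] bot by simp
  qed
  have "ba_proper_filter U"
    unfolding ba_proper_filter_def
    using up finite_meets_top finite_meets_superset[of U] bot finite_meets_inf[of _ U]
    by (meson order_refl subsetD)
  moreover have "x \<in> U \<or> - x \<in> U" for x
  proof (rule disjCI)
    assume "- x \<notin> U"
    then obtain e where "e \<in> finite_meets U" "e \<sqinter> - x = \<bottom>" using memI by blast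
    then show "x \<in> U" using up by (simp add: inf_shunt)
  qed
  ultimately show thesis using that U unfolding ba_ultrafilter_def by blast
qed

section \<open>Small joins and disjoint refinements\<close>

text \<open>The supremum, picked by its universal property because a Boolean algebra has no total
  supremum operation. It is meaningful only where a supremum exists.\<close>

definition join :: "('i \<Rightarrow> 'a::order) \<Rightarrow> 'i set \<Rightarrow> 'a" where
  "join h I = (SOME s. \<forall>u. s \<le> u \<longleftrightarrow> (\<forall>i\<in>I. h i \<le> u))"

definition disjoint_on :: "'i set \<Rightarrow> ('i \<Rightarrow> 'a::boolean_algebra) \<Rightarrow> bool" where
  "disjoint_on I h \<longleftrightarrow> pairwise (\<lambda>i j. h i \<sqinter> h j = \<bottom>) I"

lemma disjoint_onD: "disjoint_on I h \<Longrightarrow> i \<in> I \<Longrightarrow> j \<in> I \<Longrightarrow> i \<noteq> j \<Longrightarrow> h i \<sqinter> h j = \<bottom>"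
  unfolding disjoint_on_def pairwise_def by blast

locale disjointable_complete =
  fixes \<delta> :: "'d rel" and ty :: "'a::boolean_algebra itself"
  assumes card_order: "Card_order \<delta>" and infinite_Field: "infinite (Field \<delta>)"
    and disjointable: "lt_disjointable \<delta> TYPE('a)"
    and complete: "lt_complete \<delta> TYPE('a)"
    and card_algebra: "|UNIV :: 'a set| =o \<delta>"
begin

lemma small_ordLeq: "|I| \<le>o |J| \<Longrightarrow> |J| <o \<delta> \<Longrightarrow> |I| <o \<delta>"
  by (rule ordLeq_ordLess_trans)

lemma small_subset: "I \<subseteq> J \<Longrightarrow> |J| <o \<delta> \<Longrightarrow> |I| <o \<delta>"
  by (rule small_ordLeq[OF card_of_mono1])

lemma small_image: "|I| <o \<delta> \<Longrightarrow> |h ` I| <o \<delta>"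
  by (rule small_ordLeq[OF card_of_image])

lemma small_finite: "finite I \<Longrightarrow> |I| <o \<delta>"
  using finite_ordLess_infinite[of "|I|" \<delta>] card_order infinite_Field
  by (simp add: Field_card_of card_of_well_order_on card_order_on_well_order_on)

lemma not_small_iff: "\<not> |I| <o \<delta> \<longleftrightarrow> |UNIV :: 'a set| \<le>o |I|"
proof -
  have "|I| <o \<delta> \<longleftrightarrow> |I| <o |UNIV :: 'a set|"
    by (rule iffI) (rule ordLess_ordIso_trans[OF _ ordIso_symmetric[OF card_algebra]]
        ordLess_ordIso_trans[OF _ card_algebra], assumption)+
  then show ?thesis
    by (simp add: not_ordLess_iff_ordLeq card_of_Well_order)
qed

lemma infinite_UNIV: "infinite (UNIV :: 'a set)"
  using card_algebra infinite_Field card_order card_of_ordIso_finite_Field ordIso_symmetric by blast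

lemma bot_neq_top: "(\<bottom>::'a) \<noteq> \<top>"
proof
  assume "(\<bottom>::'a) = \<top>"
  then have "x = \<bottom>" for x :: 'a by (metis top_greatest bot_unique)
  then have "(UNIV :: 'a set) = {\<bottom>}" by auto
  then show False using infinite_UNIV by (metis finite.emptyI finite.insertI)
qed

lemma join_le_iff:
  fixes h :: "'i \<Rightarrow> 'a"
  assumes "|I| <o \<delta>"
  shows "join h I \<le> u \<longleftrightarrow> (\<forall>i\<in>I. h i \<le> u)"
proof -
  obtain s where "isLub UNIV (h ` I) s"
    using complete small_image[OF assms] unfolding lt_complete_def by blast
  then have "\<forall>u. s \<le> u \<longleftrightarrow> (\<forall>i\<in>I. h i \<le> u)"
    unfolding isLub_def leastP_def isUb_def setle_def setge_def by (auto intro: order_trans)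
  then have "\<forall>u. join h I \<le> u \<longleftrightarrow> (\<forall>i\<in>I. h i \<le> u)"
    unfolding join_def by (rule someI)
  then show ?thesis by blast
qed

lemma join_upper:
  fixes h :: "'i \<Rightarrow> 'a"
  shows "|I| <o \<delta> \<Longrightarrow> i \<in> I \<Longrightarrow> h i \<le> join h I"
  using join_le_iff[of I h "join h I"] by blast

text \<open>Meeting with \<open>b\<close> is left adjoint to
  \<open>c \<mapsto> - b \<squnion> c\<close>, so it distributes over small joins.\<close>

lemma join_inf_le_iff:
  fixes h :: "'i \<Rightarrow> 'a"
  shows "|I| <o \<delta> \<Longrightarrow> join h I \<sqinter> b \<le> c \<longleftrightarrow> (\<forall>i\<in>I. h i \<sqinter> b \<le> c)"
  by (simp add: shunt1 join_le_iff)

text \<open>The hypothesis speaks of cardinals on the type of \<open>\<delta>\<close>; an arbitrary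
  small index set is embedded into \<open>Field \<delta>\<close>, where its image carries such a
  cardinal.\<close>

lemma disjoint_refinement:
  fixes f :: "'i \<Rightarrow> 'a"
  assumes "|I| <o \<delta>" "\<And>i. i \<in> I \<Longrightarrow> f i \<noteq> \<bottom>"
  obtains g where "\<And>i. i \<in> I \<Longrightarrow> g i \<noteq> \<bottom>" "\<And>i. i \<in> I \<Longrightarrow> g i \<le> f i" "disjoint_on I g"
proof -
  have "|I| \<le>o |Field \<delta>|"
    using assms(1) card_of_Field_ordIso[OF card_order] ordLess_imp_ordLeq
      ordIso_symmetric ordLeq_ordIso_trans by blast
  then obtain h where h: "inj_on h I" "h ` I \<subseteq> Field \<delta>"
    using card_of_ordLeq by metis
  let ?\<kappa> = "|h ` I|"
  have fld: "Field ?\<kappa> = h ` I" by (rule Field_card_of)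
  have "Card_order ?\<kappa>" "?\<kappa> <o \<delta>"
    using small_image[OF assms(1)] by (auto simp: card_of_Card_order)
  moreover have "(\<lambda>x. f (inv_into I h x)) \<in> Field ?\<kappa> \<rightarrow> - {\<bottom>}"
    unfolding fld using assms(2) h by auto
  ultimately obtain g where g: "g \<in> Field ?\<kappa> \<rightarrow> - {\<bottom>}"
    "\<forall>\<alpha> \<in> Field ?\<kappa>. g \<alpha> \<le> f (inv_into I h \<alpha>)"
    "\<forall>\<alpha> \<in> Field ?\<kappa>. \<forall>\<beta> \<in> underS ?\<kappa> \<alpha>. g \<alpha> \<sqinter> g \<beta> = \<bottom>"
    using disjointable unfolding lt_disjointable_def by blast
  \<comment> \<open>Disjointness is given only for \<open>\<beta>\<close> below
    \<open>\<alpha>\<close>; totality of the order and symmetry of the meet extend it to all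
    distinct pairs.\<close>
  have tot: "x \<in> underS ?\<kappa> y \<or> y \<in> underS ?\<kappa> x" if "x \<in> h ` I" "y \<in> h ` I" "x \<noteq> y" for x y
    using that card_of_Well_order[of "h ` I"] fld
    unfolding well_order_on_def linear_order_on_def total_on_def underS_def by auto
  have "g (h i) \<sqinter> g (h j) = \<bottom>" if "i \<in> I" "j \<in> I" "i \<noteq> j" for i j
  proof -
    have "h i \<noteq> h j" using h(1) that by (auto dest: inj_onD)
    then show ?thesis using tot[of "h i" "h j"] g(3) that fld by (metis imageI inf_commute)
  qed
  then show thesis
    using that[of "\<lambda>i. g (h i)"] g(1,2) fld h(1)
    by (auto simp: Pi_iff disjoint_on_def pairwise_def)
qed

text \<open>Meeting with \<open>a j\<close> kills every \<open>c i\<close> with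
  \<open>i \<noteq> j\<close>. Thus elements below a disjoint family are glued into one element from
  which each can be recovered.\<close>

lemma join_inf_disjoint:
  fixes a c :: "'i \<Rightarrow> 'a"
  assumes "|I| <o \<delta>" "disjoint_on I a" "\<And>i. i \<in> I \<Longrightarrow> c i \<le> a i" "j \<in> I"
  shows "join c I \<sqinter> a j = c j"
proof (rule order.antisym)
  have "c i \<sqinter> a j \<le> c j" if "i \<in> I" for i
  proof (cases "i = j")
    case False
    have "c i \<sqinter> a j \<le> a i \<sqinter> a j" using assms(3)[OF that] by (simp add: le_infI1)
    then show ?thesis using disjoint_onD[OF assms(2) that assms(4) False] by (simp add: bot_unique)
  qed simp
  then show "join c I \<sqinter> a j \<le> c j" by (simp add: join_inf_le_iff assms(1))
  show "c j \<le> join c I \<sqinter> a j" using assms join_upper by simp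
qed

text \<open>Distributing both joins leaves meets \<open>h k \<sqinter> h j\<close>, and disjointness
  kills those with \<open>k \<noteq> j\<close>. This is the source of multiplicativity.\<close>

lemma join_inf_join:
  fixes h :: "'i \<Rightarrow> 'a"
  assumes I: "|I| <o \<delta>" and dj: "disjoint_on I h" and "J \<subseteq> I" "K \<subseteq> I"
  shows "join h J \<sqinter> join h K = join h (J \<inter> K)"
proof (rule order.antisym)
  have small: "|J| <o \<delta>" "|K| <o \<delta>" "|J \<inter> K| <o \<delta>"
    using assms(3,4) by (auto intro: small_subset[OF _ I])
  have "h k \<sqinter> h j \<le> join h (J \<inter> K)" if "j \<in> J" "k \<in> K" for j k
  proof (cases "k = j")
    case True
    then show ?thesis using that small join_upper[of "J \<inter> K" j h] by simp
  next
    case False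
    then have "h k \<sqinter> h j = \<bottom>" using that assms by (intro disjoint_onD[OF dj]) auto
    then show ?thesis by simp
  qed
  then have "h j \<sqinter> join h K \<le> join h (J \<inter> K)" if "j \<in> J" for j
    using that join_inf_le_iff[OF small(2), of h "h j"] by (metis inf_commute)
  then show "join h J \<sqinter> join h K \<le> join h (J \<inter> K)"
    by (simp add: join_inf_le_iff small)
  show "join h (J \<inter> K) \<le> join h J \<sqinter> join h K"
    using small join_upper[of J _ h] join_upper[of K _ h] by (simp add: join_le_iff)
qed

section \<open>Cardinal arithmetic below \<delta>\<close>

lemma card_below:
  fixes a :: 'a
  assumes "a \<noteq> \<bottom>"
  shows "|UNIV :: 'a set| \<le>o |{x. x \<le> a}|"
proof (rule ccontr)
  let ?I = "{x. x \<le> a}"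
  assume "\<not> ?thesis"
  then have I: "|?I| <o \<delta>" using not_small_iff by blast
  obtain h where h: "\<And>i. i \<in> ?I \<Longrightarrow> h i \<noteq> \<bottom>" "\<And>i. i \<in> ?I \<Longrightarrow> h i \<le> a" "disjoint_on ?I h"
    using disjoint_refinement[OF I, of "\<lambda>_. a"] assms by blast
  \<comment> \<open>An index \<open>j\<close> in \<open>J\<close> but not in \<open>K\<close> would
    make \<open>h j\<close> disjoint from \<open>join h K\<close> and also below it, hence zero. So
    distinct index sets have distinct joins.\<close>
  have sub: "J \<subseteq> K" if "J \<subseteq> ?I" "K \<subseteq> ?I" "join h J = join h K" for J K
  proof
    fix j assume j: "j \<in> J"
    have small: "|J| <o \<delta>" "|K| <o \<delta>" using small_subset I that by blast+
    show "j \<in> K"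
    proof (rule ccontr)
      assume "j \<notin> K"
      then have "h k \<sqinter> h j \<le> \<bottom>" if "k \<in> K" for k
        using that j \<open>J \<subseteq> ?I\<close> \<open>K \<subseteq> ?I\<close> disjoint_onD[OF h(3), of k j]
        by (metis order_refl subsetD)
      then have "join h K \<sqinter> h j \<le> \<bottom>" using join_inf_le_iff[OF small(2)] by blast
      moreover have "h j \<le> join h K" using join_upper[OF small(1) j, of h] that(3) by simp
      ultimately have "h j = \<bottom>" by (simp add: inf.absorb2 bot_unique)
      then show False using h(1) j that(1) by blast
    qed
  qed
  have "inj_on (join h) (Pow ?I)"
    by (rule inj_onI) (metis PowD order.antisym sub)
  moreover have "join h ` Pow ?I \<subseteq> ?I"
  proof
    fix x assume "x \<in> join h ` Pow ?I"
    then obtain J where "J \<subseteq> ?I" "x = join h J" by auto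
    then show "x \<in> ?I" using join_le_iff[OF small_subset[OF _ I]] h(2) by blast
  qed
  ultimately have "|Pow ?I| \<le>o |?I|" using card_of_ordLeq by blast
  then show False using card_of_Pow not_ordLess_ordLeq by blast
qed

text \<open>A diagonal argument as in the proof of the theorem of Koenig, along a disjoint family
  indexed by \<open>I\<close>; in particular \<open>\<delta>\<close> is regular.\<close>

lemma small_UN:
  assumes I: "|I| <o \<delta>" and A: "\<And>i. i \<in> I \<Longrightarrow> |A i| <o \<delta>"
  shows "|\<Union>i\<in>I. A i| <o \<delta>"
proof (rule ccontr)
  assume "\<not> ?thesis"
  then have "|UNIV :: 'a set| \<le>o |\<Union>i\<in>I. A i|" using not_small_iff by blast
  then obtain p :: "_ \<Rightarrow> 'a" where p: "p ` (\<Union>i\<in>I. A i) = UNIV"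
    unfolding card_of_ordLeq2[OF UNIV_not_empty, symmetric] by blast
  obtain a :: "_ \<Rightarrow> 'a" where a: "\<And>i. i \<in> I \<Longrightarrow> a i \<noteq> \<bottom>" "disjoint_on I a"
    using disjoint_refinement[OF I, of "\<lambda>_. \<top>"] bot_neq_top by metis
  \<comment> \<open>The traces \<open>p b \<sqinter> a i\<close> with \<open>b \<in> A i\<close> are
    too few to exhaust the elements below \<open>a i\<close>; \<open>c i\<close> will be one that
    they miss.\<close>
  have "\<exists>c \<le> a i. c \<notin> (\<lambda>b. p b \<sqinter> a i) ` A i" if i: "i \<in> I" for i
  proof (rule ccontr)
    assume "\<not> ?thesis"
    then have "{x. x \<le> a i} \<subseteq> (\<lambda>b. p b \<sqinter> a i) ` A i" by blast
    then have "|{x. x \<le> a i}| <o \<delta>" using small_subset small_image[OF A[OF i]] by blast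
    then show False using card_below[OF a(1)[OF i]] not_small_iff by blast
  qed
  then obtain c where c: "\<And>i. i \<in> I \<Longrightarrow> c i \<le> a i" "\<And>i. i \<in> I \<Longrightarrow> c i \<notin> (\<lambda>b. p b \<sqinter> a i) ` A i"
    by metis
  \<comment> \<open>By surjectivity of \<open>p\<close>, the glued element is \<open>p b\<close> for
    some \<open>b \<in> A j\<close>, so its trace on \<open>a j\<close> is both \<open>c j\<close>
    and a value that \<open>c j\<close> avoids.\<close>
  obtain j b where j: "j \<in> I" "b \<in> A j" "p b = join c I"
    using p by (metis UNIV_I UN_E image_iff)
  then have "c j = p b \<sqinter> a j" using join_inf_disjoint[OF I a(2) c(1) j(1)] by simp
  then show False using c(2)[OF j(1)] j(2) by blast
qed

lemma small_Un: "|I| <o \<delta> \<Longrightarrow> |J| <o \<delta> \<Longrightarrow> |I \<union> J| <o \<delta>"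
  using card_of_Un_ordLess_infinite_Field infinite_Field card_order by blast

lemma small_Times:
  assumes "|I| <o \<delta>" "|J| <o \<delta>"
  shows "|I \<times> J| <o \<delta>"
proof -
  have "|\<Union>i\<in>I. Pair i ` J| <o \<delta>"
    by (rule small_UN[OF assms(1) small_image[OF assms(2)]])
  moreover have "(\<Union>i\<in>I. Pair i ` J) = I \<times> J" by auto
  ultimately show ?thesis by simp
qed

lemma small_Fpow: "|I| <o \<delta> \<Longrightarrow> |Fpow I| <o \<delta>"
proof (cases "finite I")
  case True
  then show ?thesis
    using small_finite[of "Fpow I"] by (simp add: Fpow_Pow_finite)
qed (use card_of_Fpow_le small_ordLeq in blast)

lemma small_finite_meets: "|E| <o \<delta> \<Longrightarrow> |finite_meets E| <o \<delta>"
  unfolding finite_meets_def by (intro small_image small_Fpow)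

text \<open>Each \<open>c i\<close> embeds the whole algebra below \<open>a i\<close>, and
  \<open>code\<close> glues the images \<open>c i (f i)\<close>; meeting with \<open>a i\<close> and
  inverting \<open>c i\<close> reads \<open>f i\<close> back.\<close>

lemma function_code:
  assumes I: "|I| <o \<delta>"
  obtains code :: "('i \<Rightarrow> 'a) \<Rightarrow> 'a"
  where "\<And>f g i. code f = code g \<Longrightarrow> i \<in> I \<Longrightarrow> f i = g i"
proof -
  obtain a :: "_ \<Rightarrow> 'a" where a: "\<And>i. i \<in> I \<Longrightarrow> a i \<noteq> \<bottom>" "disjoint_on I a"
    using disjoint_refinement[OF I, of "\<lambda>_. \<top>"] bot_neq_top by metis
  have "\<exists>c :: 'a \<Rightarrow> 'a. inj c \<and> range c \<subseteq> {x. x \<le> a i}" if "i \<in> I" for i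
    using card_below[OF a(1)[OF that]] unfolding card_of_ordLeq[symmetric] .
  then obtain c :: "'i \<Rightarrow> 'a \<Rightarrow> 'a"
    where c: "\<And>i. i \<in> I \<Longrightarrow> inj (c i)" "\<And>i x. i \<in> I \<Longrightarrow> c i x \<le> a i"
    by (metis mem_Collect_eq rangeI subsetD)
  define code where "code f = join (\<lambda>i. c i (f i)) I" for f
  have code: "code f \<sqinter> a i = c i (f i)" if "i \<in> I" for f i
    unfolding code_def by (rule join_inf_disjoint[OF I a(2) _ that]) (rule c(2))
  have "f i = g i" if "code f = code g" "i \<in> I" for f g i
  proof -
    have "c i (f i) = c i (g i)"
      using code[OF that(2), of f] code[OF that(2), of g] unfolding that(1) by simp
    then show ?thesis using c(1)[OF that(2)] by (simp add: inj_eq)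
  qed
  then show thesis by (rule that[of code])
qed

section \<open>Multiplicative refinement of a monotonic function\<close>

lemma multiplicative_refinement:
  fixes f :: "'i set \<Rightarrow> 'a"
  assumes E: "|E| <o \<delta>" and X: "|X| <o \<delta>" and mono: "monotonic_on X f"
    and fip: "fip (E \<union> f ` Fpow X)"
  obtains g where "multiplicative_on X g" "\<And>S. S \<in> Fpow X \<Longrightarrow> g S \<le> f S"
    "fip (E \<union> g ` Fpow X)"
proof -
  let ?I = "Fpow X \<times> finite_meets E"
  have I: "|?I| <o \<delta>" using small_Times small_Fpow[OF X] small_finite_meets[OF E] by blast
  have ne: "f S \<sqinter> e \<noteq> \<bottom>" if "S \<in> Fpow X" "e \<in> finite_meets E" for S e
  proof -
    let ?D = "E \<union> f ` Fpow X"
    have "e \<in> finite_meets ?D"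
      using that(2) Fpow_mono[of E ?D] unfolding finite_meets_def by blast
    moreover have "f S \<in> finite_meets ?D" using finite_meets_superset[of ?D] that(1) by blast
    ultimately show ?thesis
      using fip fip_iff_finite_meets[OF bot_neq_top] finite_meets_inf by metis
  qed
  obtain h where h: "\<And>i. i \<in> ?I \<Longrightarrow> h i \<noteq> \<bottom>" "\<And>i. i \<in> ?I \<Longrightarrow> h i \<le> (\<lambda>(S, e). f S \<sqinter> e) i"
    "disjoint_on ?I h"
    by (rule disjoint_refinement[OF I, of "\<lambda>(S, e). f S \<sqinter> e"]) (use ne in \<open>auto\<close>)
  \<comment> \<open>Passing to supersets turns a union of sets into an intersection of index sets,
    which \<open>join h\<close> turns into a meet.\<close>
  define above where "above T = {(S, e) \<in> ?I. T \<subseteq> S}" for T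
  define g where "g T = join h (above T)" for T
  have above: "above T \<subseteq> ?I" for T unfolding above_def by auto
  have small: "|above T| <o \<delta>" for T using small_subset[OF above I] .
  have "g (S \<union> T) = g S \<sqinter> g T" for S T
  proof -
    have "above (S \<union> T) = above S \<inter> above T" unfolding above_def by auto
    then show ?thesis unfolding g_def using join_inf_join[OF I h(3) above above] by simp
  qed
  note g_Un = this
  have g_le: "g T \<le> f T" if T: "T \<in> Fpow X" for T
    unfolding g_def join_le_iff[OF small]
  proof
    fix i assume "i \<in> above T"
    then obtain S e where i: "i = (S, e)" "S \<in> Fpow X" "e \<in> finite_meets E" "T \<subseteq> S"
      unfolding above_def by auto
    have "h i \<le> f S" using h(2)[of i] i by simp
    also have "f S \<le> f T" using mono T i unfolding monotonic_on_def by blast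
    finally show "h i \<le> f T" .
  qed
  have "fip (E \<union> g ` Fpow X)"
  proof (rule fip_Un[OF bot_neq_top])
    show "g ` Fpow X \<noteq> {}" by (simp add: Fpow_not_empty)
  next
    fix x y assume "x \<in> g ` Fpow X" "y \<in> g ` Fpow X"
    then obtain S T where ST: "S \<in> Fpow X" "T \<in> Fpow X" "x = g S" "y = g T" by blast
    then have "S \<union> T \<in> Fpow X" by (auto simp: Fpow_def)
    then show "x \<sqinter> y \<in> g ` Fpow X" using g_Un[of S T] ST by (metis imageI)
  next
    fix e d assume e: "e \<in> finite_meets E" and "d \<in> g ` Fpow X"
    then obtain T where T: "T \<in> Fpow X" "d = g T" by blast
    \<comment> \<open>The index \<open>(T, e)\<close> itself puts a nonzero \<open>h (T, e)\<close>
      below both \<open>g T\<close> and \<open>e\<close>; this is why \<open>e\<close> is part of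
      the index.\<close>
    then have i: "(T, e) \<in> above T" "(T, e) \<in> ?I" unfolding above_def using e by auto
    have "h (T, e) \<le> d" unfolding T g_def by (rule join_upper[OF small i(1)])
    moreover have "h (T, e) \<le> e" using h(2)[OF i(2)] by simp
    ultimately have "h (T, e) \<le> e \<sqinter> d" by simp
    then show "e \<sqinter> d \<noteq> \<bottom>" using h(1)[OF i(2)] by (metis bot_unique)
  qed
  then show thesis using that[of g] g_Un g_le unfolding multiplicative_on_def by blast
qed

section \<open>Countable incompleteness\<close>

lemma countably_incomplete_extension:
  fixes E :: "'a set"
  assumes nat: "|UNIV :: nat set| <o \<delta>" and E: "|E| <o \<delta>" and "fip E"
  obtains Y where "countable Y" "isGlb UNIV Y \<bottom>" "fip (E \<union> Y)"
proof -
  let ?I = "(UNIV :: nat set) \<times> finite_meets E"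
  have I: "|?I| <o \<delta>" using small_Times nat small_finite_meets[OF E] by blast
  have "snd i \<noteq> \<bottom>" if "i \<in> ?I" for i
    using that assms(3) fip_iff_finite_meets[OF bot_neq_top, of E] by auto
  then obtain h where h: "\<And>i. i \<in> ?I \<Longrightarrow> h i \<noteq> \<bottom>" "\<And>i. i \<in> ?I \<Longrightarrow> h i \<le> snd i"
    "disjoint_on ?I h"
    using disjoint_refinement[OF I, of snd] by blast
  define c where "c n = join h ({n..} \<times> finite_meets E)" for n :: nat
  have sub: "{n..} \<times> finite_meets E \<subseteq> ?I" for n :: nat by auto
  have small: "|{n..} \<times> finite_meets E| <o \<delta>" for n :: nat using small_subset[OF sub I] .
  have c_inf: "c m \<sqinter> c n = c (max m n)" for m n
  proof -
    have "{m..} \<times> finite_meets E \<inter> {n..} \<times> finite_meets E = {max m n..} \<times> finite_meets E"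
      by auto
    then show ?thesis unfolding c_def using join_inf_join[OF I h(3) sub sub] by simp
  qed
  have "b \<le> \<bottom>" if b: "\<And>n. b \<le> c n" for b
  proof -
    \<comment> \<open>Row \<open>m\<close> is disjoint from \<open>c (Suc m)\<close>, the first tail
      that leaves it out, and \<open>b\<close> lies below that tail. So \<open>b\<close> misses
      every row, while \<open>c 0\<close> is the join of all rows.\<close>
    have "h (m, e) \<sqinter> b \<le> \<bottom>" if e: "e \<in> finite_meets E" for m e
    proof -
      have "h k \<sqinter> h (m, e) \<le> \<bottom>" if "k \<in> {Suc m..} \<times> finite_meets E" for k
        using disjoint_onD[OF h(3), of k "(m, e)"] that e by auto
      then have "c (Suc m) \<sqinter> h (m, e) \<le> \<bottom>"
        unfolding c_def join_inf_le_iff[OF small] by blast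
      moreover have "h (m, e) \<sqinter> b \<le> c (Suc m) \<sqinter> h (m, e)"
        using b[of "Suc m"] by (simp add: le_infI2)
      ultimately show ?thesis by (rule order_trans[rotated])
    qed
    then have "c 0 \<sqinter> b \<le> \<bottom>" unfolding c_def join_inf_le_iff[OF small] by auto
    then show ?thesis using b[of 0] by (simp add: inf.absorb2)
  qed
  then have "isGlb UNIV (range c) \<bottom>"
    unfolding isGlb_def greatestP_def isLb_def setle_def setge_def by auto
  moreover have "fip (E \<union> range c)"
  proof (rule fip_Un[OF bot_neq_top])
    fix e d assume e: "e \<in> finite_meets E" and "d \<in> range c"
    then obtain n where d: "d = c n" by blast
    have i: "(n, e) \<in> {n..} \<times> finite_meets E" using e by simp
    have "h (n, e) \<le> d" unfolding d c_def by (rule join_upper[OF small i])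
    moreover have "h (n, e) \<le> e" using h(2)[of "(n, e)"] e by simp
    ultimately have "h (n, e) \<le> e \<sqinter> d" by simp
    then show "e \<sqinter> d \<noteq> \<bottom>" using h(1)[of "(n, e)"] e by (metis UNIV_I SigmaI bot_unique)
  qed (use c_inf in auto)
  ultimately show thesis using that[of "range c"] by simp
qed

text \<open>A nonzero lower bound \<open>b\<close> of \<open>U\<close> would have two disjoint
  nonzero parts. As \<open>U\<close> contains \<open>g True\<close> or its complement,
  \<open>b\<close> lies below one of these, which makes \<open>g False\<close> or
  \<open>g True\<close> zero.\<close>

lemma countably_incomplete_if_countable:
  fixes U :: "'a set"
  assumes "countable (UNIV :: 'a set)" and U: "ba_ultrafilter U"
  shows "countably_incomplete U"
proof -
  have "b \<le> \<bottom>" if b: "\<And>u. u \<in> U \<Longrightarrow> b \<le> u" for b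
  proof (rule ccontr)
    assume "\<not> b \<le> \<bottom>"
    then have nz: "b \<noteq> \<bottom>" by auto
    have "|UNIV :: bool set| <o \<delta>" by (rule small_finite) simp
    then obtain g where g: "\<And>i. g i \<noteq> \<bottom>" "\<And>i. g i \<le> b" "disjoint_on (UNIV :: bool set) g"
      using disjoint_refinement[of "UNIV :: bool set" "\<lambda>_. b"] nz by (metis UNIV_I)
    have "g True \<sqinter> g False = \<bottom>" using disjoint_onD[OF g(3), of True False] by simp
    moreover have "g True \<in> U \<or> - g True \<in> U" using U unfolding ba_ultrafilter_def by blast
    then have "b \<le> g True \<or> b \<le> - g True" using b by blast
    ultimately show False
      using g(1,2) by (metis inf.absorb2 inf_shunt order_trans inf.absorb1 inf_compl_bot)
  qed
  then have "isGlb UNIV U \<bottom>"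
    unfolding isGlb_def greatestP_def isLb_def setle_def setge_def by auto
  moreover have "countable U" using countable_subset[OF subset_UNIV assms(1)] .
  ultimately show ?thesis unfolding countably_incomplete_def by (intro exI[of _ U]) simp
qed

section \<open>Transfinite recursion over all monotonic functions\<close>

text \<open>A well-order of type \<delta>: its elements are the stages of the recursion, and its
  proper initial segments, all small, serve as index sets.\<close>

abbreviation (input) "wo \<equiv> |UNIV :: 'a set|"

lemma wo_Well_order: "Well_order wo" and wo_Card_order: "Card_order wo" and Field_wo: "Field wo = UNIV"
  by (simp_all add: card_of_card_order_on card_of_well_order_on Field_card_of)

lemma small_underS: "|underS wo a| <o \<delta>"
  using card_of_underS[OF wo_Card_order, of a] Field_wo ordLess_ordIso_trans card_algebra by blast

text \<open>A surjection onto pairs lists every segment with every code, and a code determines a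
  function on the finite subsets of its segment.\<close>

lemma enumerate_functions:
  obtains X :: "'a \<Rightarrow> 'a set" and F :: "'a \<Rightarrow> 'a set \<Rightarrow> 'a"
  where "\<And>i. |X i| <o \<delta>"
    and "\<And>a f. \<exists>i. X i = underS wo a \<and> (\<forall>S \<in> Fpow (X i). F i S = f S)"
proof -
  have "\<exists>code :: ('a set \<Rightarrow> 'a) \<Rightarrow> 'a. \<forall>f g. code f = code g \<longrightarrow>
      (\<forall>S \<in> Fpow (underS wo a). f S = g S)" for a
    by (rule function_code[OF small_Fpow[OF small_underS[of a]]]) blast
  then obtain code :: "'a \<Rightarrow> ('a set \<Rightarrow> 'a) \<Rightarrow> 'a" where code:
    "\<And>a f g S. code a f = code a g \<Longrightarrow> S \<in> Fpow (underS wo a) \<Longrightarrow> f S = g S"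
    by metis
  have "|(UNIV :: 'a set) \<times> (UNIV :: 'a set)| \<le>o |UNIV :: 'a set|"
    using card_of_Times_same_infinite[OF infinite_UNIV] ordIso_iff_ordLeq by blast
  then obtain p :: "'a \<Rightarrow> 'a \<times> 'a" where p: "surj p"
    using card_of_ordLeq2[of "(UNIV :: 'a set) \<times> (UNIV :: 'a set)" "UNIV :: 'a set"] by auto
  define X where "X i = underS wo (fst (p i))" for i
  \<comment> \<open>Decoding by choice; the value is arbitrary when \<open>snd (p i)\<close> is no
    code.\<close>
  define F where "F i = (SOME f. code (fst (p i)) f = snd (p i))" for i
  show thesis
  proof (rule that)
    show "|X i| <o \<delta>" for i unfolding X_def by (rule small_underS)
  next
    fix a f
    obtain i where i: "p i = (a, code a f)" using p by (metis surj_def)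
    have "code a (F i) = code a f"
      unfolding F_def i fst_conv snd_conv by (rule someI[where x = f]) (rule refl)
    then show "\<exists>i. X i = underS wo a \<and> (\<forall>S \<in> Fpow (X i). F i S = f S)"
      using code i unfolding X_def by (intro exI[of _ i]) auto
  qed
qed

text \<open>If the finite intersection property of \<^term>\<open>q \<union> f ` Fpow X\<close> fails, no filter containing \<open>q\<close>
  contains the range of \<open>f\<close>. Hence each \<open>f\<close> has to be considered at one stage only, although
  that stage may come before the range of \<open>f\<close> has been added.\<close>

definition refined :: "'i set \<Rightarrow> ('i set \<Rightarrow> 'a) \<Rightarrow> 'a set \<Rightarrow> bool" where
  "refined X f q \<longleftrightarrow> (monotonic_on X f \<and> fip (q \<union> f ` Fpow X) \<longrightarrow>
    (\<exists>g. multiplicative_on X g \<and> (\<forall>S \<in> Fpow X. g S \<le> f S) \<and> g ` Fpow X \<subseteq> q))"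

lemma refined_extension:
  assumes "|p| <o \<delta>" "fip p" "|X| <o \<delta>"
  obtains q where "|q| <o \<delta>" "fip q" "p \<subseteq> q" "refined X f q"
proof (cases "monotonic_on X f \<and> fip (p \<union> f ` Fpow X)")
  case True
  then obtain g where g: "multiplicative_on X g" "\<And>S. S \<in> Fpow X \<Longrightarrow> g S \<le> f S"
    "fip (p \<union> g ` Fpow X)"
    using multiplicative_refinement[OF assms(1,3)] by metis
  show thesis
  proof (rule that)
    show "|p \<union> g ` Fpow X| <o \<delta>" using small_Un[OF assms(1)] small_image[OF small_Fpow[OF assms(3)]] .
    show "refined X f (p \<union> g ` Fpow X)" unfolding refined_def using g by blast
  qed (use g in auto)
next
  \<comment> \<open>The premise in \<open>refined X f p\<close> is false, so \<open>p\<close> itself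
    serves.\<close>
  case False
  then show thesis using that[of p] assms unfolding refined_def by blast
qed

lemma refined_mono:
  assumes "refined X f q" "q \<subseteq> U" "monotonic_on X f" "fip U" "f ` Fpow X \<subseteq> U"
  obtains g where "multiplicative_on X g" "\<And>S. S \<in> Fpow X \<Longrightarrow> g S \<le> f S" "g ` Fpow X \<subseteq> U"
proof -
  have "fip (q \<union> f ` Fpow X)" using fip_subset[OF assms(4)] assms(2,5) by simp
  then obtain g where "multiplicative_on X g" "\<And>S. S \<in> Fpow X \<Longrightarrow> g S \<le> f S" "g ` Fpow X \<subseteq> q"
    using assms(1,3) unfolding refined_def by blast
  then show thesis using that assms(2) by blast
qed

lemma refined_tower:
  fixes X :: "'a \<Rightarrow> 'i set"
  assumes E: "|E| <o \<delta>" "fip E" and X: "\<And>i. |X i| <o \<delta>"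
  shows "\<exists>s. fip (\<Union>i. s i) \<and> E \<subseteq> (\<Union>i. s i) \<and> (\<forall>i :: 'a. refined (X i) (F i) (s i))"
proof -
  let ?R = "wo - Id"
  define P where "P f i q \<longleftrightarrow> |q| <o \<delta> \<and> fip q \<and> E \<subseteq> q \<and> (\<forall>j \<in> underS wo i. f j \<subseteq> q) \<and>
    refined (X i) (F i) q" 
    for f :: "'a \<Rightarrow> 'a set" and i q
  have R: "(j, i) \<in> ?R \<longleftrightarrow> j \<in> underS wo i" for i j unfolding underS_def by auto
  have tot: "i = j \<or> i \<in> underS wo j \<or> j \<in> underS wo i" for i j
    using wo_Well_order Field_wo
    unfolding well_order_on_def linear_order_on_def total_on_def underS_def by auto
  \<comment> \<open>Stated for any set \<open>A\<close> of stages, to serve both for the earlier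
    stages within the recursion and for all stages at the end. Inserting \<open>E\<close> covers the
    first stage, which has no predecessors.\<close>
  have chain: "fip (\<Union>(insert E (f ` A)))"
    if "\<And>i. i \<in> A \<Longrightarrow> P f i (f i)" for f :: "'a \<Rightarrow> 'a set" and A
  proof (rule fip_Union_chain)
    have "f i \<subseteq> f j \<or> f j \<subseteq> f i" if "i \<in> A" "j \<in> A" for i j
      using tot[of i j] \<open>\<And>i. i \<in> A \<Longrightarrow> P f i (f i)\<close> that unfolding P_def by blast
    moreover have "E \<subseteq> f i" if "i \<in> A" for i
      using \<open>\<And>i. i \<in> A \<Longrightarrow> P f i (f i)\<close> that unfolding P_def by blast
    ultimately show "subset.chain UNIV (insert E (f ` A))"
      unfolding subset_chain_def by blast
    show "fip q" if "q \<in> insert E (f ` A)" for q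
      using that E(2) \<open>\<And>i. i \<in> A \<Longrightarrow> P f i (f i)\<close> unfolding P_def by blast
  qed simp
  have "\<exists>s. \<forall>i. P s i (s i)"
  proof (rule dependent_wf_choice[of ?R])
    show "wf ?R" using wo_Well_order unfolding well_order_on_def by blast
  next
    fix f g :: "'a \<Rightarrow> 'a set" and i q
    assume "\<And>j. (j, i) \<in> ?R \<Longrightarrow> f j = g j"
    then have "\<And>j. j \<in> underS wo i \<Longrightarrow> f j = g j" using R by blast
    then show "P f i q = P g i q" unfolding P_def by auto
  next
    fix i and f :: "'a \<Rightarrow> 'a set"
    assume "\<And>j. (j, i) \<in> ?R \<Longrightarrow> P f j (f j)"
    then have f: "P f j (f j)" if "j \<in> underS wo i" for j using R that by blast
    let ?p = "\<Union>(insert E (f ` underS wo i))"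
    \<comment> \<open>Regularity of \<delta> keeps the union of the earlier stages small, also at
      limits.\<close>
    have "|\<Union>j \<in> underS wo i. f j| <o \<delta>"
      by (rule small_UN[OF small_underS]) (use f in \<open>auto simp: P_def\<close>)
    then have "|?p| <o \<delta>" using small_Un[OF E(1)] by simp
    then obtain q where "|q| <o \<delta>" "fip q" "?p \<subseteq> q" "refined (X i) (F i) q"
      using refined_extension[OF _ chain[OF f] X] by blast
    then show "\<exists>q. P f i q" unfolding P_def by (intro exI[of _ q]) auto
  qed
  then obtain s where s: "\<And>i. P s i (s i)" by blast
  have "\<Union>(insert E (range s)) = (\<Union>i. s i)" using s unfolding P_def by blast
  then show ?thesis
    using chain[of UNIV s] s unfolding P_def by (intro exI[of _ s]) auto
qed

section \<open>Goodness and the final assembly\<close>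

text \<open>Every cardinal below \<delta> is isomorphic to a proper initial segment of
  \<open>wo\<close>; a bijection carries \<open>f\<close> to that segment and the multiplicative
  \<open>g\<close> back.\<close>

lemma lt_goodI:
  fixes U :: "'a set"
  assumes good: "\<And>a f. monotonic_on (underS wo a) f \<Longrightarrow> f ` Fpow (underS wo a) \<subseteq> U \<Longrightarrow>
    \<exists>g. multiplicative_on (underS wo a) g \<and> (\<forall>S \<in> Fpow (underS wo a). g S \<le> f S) \<and>
      g ` Fpow (underS wo a) \<subseteq> U"
  shows "lt_good \<delta> U"
  unfolding lt_good_def
proof (intro allI impI)
  fix \<kappa> :: "'d rel" and f
  assume \<kappa>: "Card_order \<kappa> \<and> \<kappa> <o \<delta>"
    and f: "f \<in> Fpow (Field \<kappa>) \<rightarrow> U \<and> monotonic_on (Field \<kappa>) f"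
  have "\<kappa> <o wo" using \<kappa> ordLess_ordIso_trans ordIso_symmetric[OF card_algebra] by blast
  then obtain a where a: "\<kappa> =o Restr wo (underS wo a)"
    using ordLess_iff_ordIso_Restr[OF wo_Well_order] \<kappa> card_order_on_well_order_on by blast
  have "wo_rel.ofilter wo (underS wo a)"
    using wo_Well_order by (simp add: wo_rel_def wo_rel.underS_ofilter)
  then have "Field (Restr wo (underS wo a)) = underS wo a"
    by (rule Field_Restr_ofilter[OF wo_Well_order])
  then have "|underS wo a| =o |Field \<kappa>|" using card_of_cong[OF a] ordIso_symmetric by simp
  then obtain h where h: "bij_betw h (underS wo a) (Field \<kappa>)" using card_of_ordIso by blast
  define k where "k = inv_into (underS wo a) h"
  have k: "bij_betw k (Field \<kappa>) (underS wo a)" unfolding k_def by (rule bij_betw_inv_into[OF h])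
  have hF: "h ` S \<in> Fpow (Field \<kappa>)" if "S \<in> Fpow (underS wo a)" for S
    using that h unfolding Fpow_def bij_betw_def by auto
  have kF: "k ` S \<in> Fpow (underS wo a)" if "S \<in> Fpow (Field \<kappa>)" for S
    using that k unfolding Fpow_def bij_betw_def by auto
  have hk: "h ` k ` S = S" if "S \<in> Fpow (Field \<kappa>)" for S
    using that bij_betw_inv_into_right[OF h] unfolding Fpow_def k_def by (force simp: image_image)
  have "monotonic_on (underS wo a) (\<lambda>S. f (h ` S))"
    using f hF unfolding monotonic_on_def by (meson image_mono)
  moreover have "(\<lambda>S. f (h ` S)) ` Fpow (underS wo a) \<subseteq> U" using f hF by auto
  ultimately obtain g where g: "multiplicative_on (underS wo a) g"
    "\<And>S. S \<in> Fpow (underS wo a) \<Longrightarrow> g S \<le> f (h ` S)" "g ` Fpow (underS wo a) \<subseteq> U"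
    using good[of a "\<lambda>S. f (h ` S)"] by blast
  show "\<exists>g \<in> Fpow (Field \<kappa>) \<rightarrow> U. multiplicative_on (Field \<kappa>) g \<and>
      (\<forall>S \<in> Fpow (Field \<kappa>). g S \<le> f S)"
  proof (intro bexI conjI ballI)
    show "multiplicative_on (Field \<kappa>) (\<lambda>S. g (k ` S))"
      using g(1) kF unfolding multiplicative_on_def by (simp add: image_Un)
    show "g (k ` S) \<le> f S" if "S \<in> Fpow (Field \<kappa>)" for S
      using g(2)[OF kF[OF that]] hk[OF that] by simp
    show "(\<lambda>S. g (k ` S)) \<in> Fpow (Field \<kappa>) \<rightarrow> U" using g(3) kF by auto
  qed
qed

lemma fip_ultrafilter: "ba_ultrafilter U \<Longrightarrow> fip (U :: 'a set)"
  unfolding fip_def ba_ultrafilter_def ba_proper_filter_def using Inf_fin_closed[of U] by metis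

lemma good_ultrafilter_extension:
  fixes E :: "'a set"
  assumes "|E| <o \<delta>" "fip E"
  obtains U where "ba_ultrafilter U" "lt_good \<delta> U" "E \<subseteq> U"
proof -
  obtain X :: "'a \<Rightarrow> 'a set" and F :: "'a \<Rightarrow> 'a set \<Rightarrow> 'a"
    where X: "\<And>i. |X i| <o \<delta>"
    and enum: "\<And>a f. \<exists>i. X i = underS wo a \<and> (\<forall>S \<in> Fpow (X i). F i S = f S)"
    by (rule enumerate_functions) blast
  obtain s where s: "fip (\<Union>i. s i)" "E \<subseteq> (\<Union>i. s i)" "\<And>i. refined (X i) (F i) (s i)"
    using refined_tower[OF assms, of X F, OF X] by (elim exE conjE) blast
  obtain U where U: "ba_ultrafilter U" "(\<Union>i. s i) \<subseteq> U"
    by (rule ultrafilter_extension[OF bot_neq_top s(1)])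
  have "lt_good \<delta> U"
  proof (rule lt_goodI)
    fix a f assume f: "monotonic_on (underS wo a) f" "f ` Fpow (underS wo a) \<subseteq> U"
    \<comment> \<open>On the finite subsets of the segment, \<open>f\<close> agrees with some
      \<open>F i\<close>, and stage \<open>i\<close>, refined for it, lies in
      \<open>U\<close>.\<close>
    obtain i where i: "X i = underS wo a" "\<And>S. S \<in> Fpow (X i) \<Longrightarrow> F i S = f S"
      using enum[of a f] by blast
    have "monotonic_on (X i) (F i)" "F i ` Fpow (X i) \<subseteq> U"
      using f i unfolding monotonic_on_def by auto
    then obtain g where "multiplicative_on (X i) g" "\<And>S. S \<in> Fpow (X i) \<Longrightarrow> g S \<le> F i S"
      "g ` Fpow (X i) \<subseteq> U"
      using refined_mono[OF s(3)[of i] _ _ fip_ultrafilter[OF U(1)]] U(2) by blast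
    then show "\<exists>g. multiplicative_on (underS wo a) g \<and> (\<forall>S \<in> Fpow (underS wo a). g S \<le> f S) \<and>
        g ` Fpow (underS wo a) \<subseteq> U"
      using i by (intro exI[of _ g]) auto
  qed
  moreover have "E \<subseteq> U" using s(2) U(2) by (rule order_trans)
  ultimately show thesis by (rule that[OF U(1)])
qed

theorem good_countably_incomplete_ultrafilter:
  fixes E :: "'a set"
  assumes E: "|E| <o \<delta>" "fip E"
  shows "\<exists>U. ba_ultrafilter U \<and> countably_incomplete U \<and> lt_good \<delta> U \<and> E \<subseteq> U"
proof (cases "|UNIV :: nat set| <o \<delta>")
  case True
  then obtain Y where Y: "countable Y" "isGlb UNIV Y \<bottom>" "fip (E \<union> Y)"
    using countably_incomplete_extension[OF _ E] by blast
  have "|Y| \<le>o |UNIV :: nat set|" 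
    using Y(1) unfolding countable_def card_of_ordLeq[symmetric] by simp
  \<comment> \<open>Here \<delta> is uncountable, so adding \<open>Y\<close> keeps the starting set
    small, and \<open>Y \<subseteq> U\<close> will witness incompleteness.\<close>
  then have "|E \<union> Y| <o \<delta>" using small_Un[OF E(1)] small_ordLeq True by blast
  then obtain U where "ba_ultrafilter U" "lt_good \<delta> U" "E \<union> Y \<subseteq> U"
    using good_ultrafilter_extension[OF _ Y(3)] by blast
  then show ?thesis using Y unfolding countably_incomplete_def by blast
next
  case False
  then have "|UNIV :: 'a set| \<le>o |UNIV :: nat set|" using not_small_iff by blast
  then have "countable (UNIV :: 'a set)"
    unfolding card_of_ordLeq[symmetric] countable_def by blast
  moreover obtain U where "ba_ultrafilter U" "lt_good \<delta> U" "E \<subseteq> U"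
    using good_ultrafilter_extension[OF E] by blast
  ultimately show ?thesis
    using countably_incomplete_if_countable by blast
qed

end

theorem theorem3p14:
  fixes \<delta> :: "'d rel"
    and E :: "'a::boolean_algebra set"
  assumes "Card_order \<delta>" and "infinite (Field \<delta>)"
    and "lt_disjointable \<delta> TYPE('a)"
    and "lt_complete \<delta> TYPE('a)"
    and "|UNIV :: 'a set| =o \<delta>"
    and "|E| <o \<delta>" and "fip E"
  shows "\<exists>U :: 'a set. ba_ultrafilter U \<and> countably_incomplete U \<and> lt_good \<delta> U \<and> E \<subseteq> U"
proof -
  interpret disjointable_complete \<delta> "TYPE('a)"
    using assms(1-5) by unfold_locales
  show ?thesis using assms(6,7) by (rule good_countably_incomplete_ultrafilter)
qed

end
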